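(* Let $G_1$ be a connected $\delta_1$-regular graph on $n$ vertices and $G_2$ a connected $\delta_2$-regular graph on $\delta_1$ vertices, and let $G_1\circledR G_2$ be their replacement product (with respect to an arbitrary edge labelling of $G_1$). Write $\lambda_i=\lambda(G_i)$ and $\kappa_i=\kappa(G_i)$ for $i=1,2$. Then (a) $\lambda(G_1\circledR G_2)=1$ if $\lambda_1=1$; (b) $\lambda(G_1\circledR G_2)=\lambda_1$ if $\lambda_2\geqslant \lambda_1$; (c) $\lambda(G_1\circledR G_2)=\lambda_1$ if $\kappa_1\geqslant 2$ and $\lambda_2\geqslant \lambda_1-1$; (d) $\lambda(G_1\circledR G_2)=\min\{\lambda_1,\delta_2+1\}$ if $\kappa_1\geqslant 2$ and $\lambda_2=\delta_2$.
   Context: All graphs are finite, simple, undirected, with nonempty vertex set. $\kappa(G)$ and $\lambda(G)$ denote the (vertex-)connectivity and edge-connectivity of $G$ (with the usual conventions $\kappa(K_m)=m-1$, $\lambda(K_1)=0$). Replacement product: let $G_1$ be a $\delta_1$-regular graph on $n$ vertices and $G_2$ a $\delta_2$-regular graph on $\delta_1$ vertices. For every vertex $x\in V(G_1)$, label the $\delta_1$ edges incident with $x$ bijectively by the vertices of $G_2$; $e_x^i$ denotes the edge at $x$ with label $i\in V(G_2)$ (an edge $xy$ may receive different labels at $x$ and at $y$). The replacement product $G_1\circledR G_2$ has vertex-set $V(G_1)\times V(G_2)$; two distinct vertices $(x,i)$ and $(y,j)$ are adjacent if and only if either $x=y$ and $ij\in E(G_2)$, or $xy\in E(G_1)$ and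 $e_x^i=xy=e_y^j$. *)

theory Defs
  imports Main
begin

record 'a ugraph =
  verts :: "'a set"
  edges :: "'a set set"

definition simple_graph :: "'a ugraph \<Rightarrow> bool" where
  "simple_graph G \<longleftrightarrow>
     finite (verts G) \<and> verts G \<noteq> {} \<and> (\<forall>e\<in>edges G. e \<subseteq> verts G \<and> card e = 2)"

definition incident_edges :: "'a ugraph \<Rightarrow> 'a \<Rightarrow> 'a set set" where
  "incident_edges G x = {e \<in> edges G. x \<in> e}"

definition regular_graph :: "'a ugraph \<Rightarrow> nat \<Rightarrow> bool" where
  "regular_graph G d \<longleftrightarrow> (\<forall>x\<in>verts G. card (incident_edges G x) = d)"

definition adj_rel :: "'a ugraph \<Rightarrow> ('a \<times> 'a) set" where
  "adj_rel G = {(x, y). {x, y} \<in> edges G}"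

definition connected_graph :: "'a ugraph \<Rightarrow> bool" where
  "connected_graph G \<longleftrightarrow>
     verts G \<noteq> {} \<and> (\<forall>x\<in>verts G. \<forall>y\<in>verts G. (x, y) \<in> (adj_rel G)\<^sup>*)"

definition complete_graph :: "'a ugraph \<Rightarrow> bool" where
  "complete_graph G \<longleftrightarrow>
     (\<forall>x\<in>verts G. \<forall>y\<in>verts G. x \<noteq> y \<longrightarrow> {x, y} \<in> edges G)"

definition del_verts :: "'a ugraph \<Rightarrow> 'a set \<Rightarrow> 'a ugraph" where
  "del_verts G S = \<lparr>verts = verts G - S, edges = {e \<in> edges G. e \<inter> S = {}}\<rparr>"

definition del_edges :: "'a ugraph \<Rightarrow> 'a set set \<Rightarrow> 'a ugraph" where
  "del_edges G F = \<lparr>verts = verts G, edges = edges G - F\<rparr>"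

text \<open>The sets under \<open>Min\<close> below are finite and nonempty for every simple graph: a
  non-complete graph is disconnected by deleting all vertices except two non-adjacent
  ones, and a graph with at least two vertices by deleting all edges. Requiring \<open>S\<close> to
  be a proper subset of the vertex set keeps the graph without vertices, which
  \<open>connected_graph\<close> rejects, from counting as a disconnected remainder.\<close>

definition vertex_connectivity :: "'a ugraph \<Rightarrow> nat" where
  "vertex_connectivity G =
     (if complete_graph G then card (verts G) - 1
      else Min {card S | S. S \<subset> verts G \<and> \<not> connected_graph (del_verts G S)})"

definition edge_connectivity :: "'a ugraph \<Rightarrow> nat" where
  "edge_connectivity G =
     (if card (verts G) = 1 then 0
      else Min {card F | F. F \<subseteq> edges G \<and> \<not> connected_graph (del_edges G F)})"

text \<open>\<open>l x i\<close> is the edge \<open>e\<^sub>x\<^sup>i\<close> at \<open>x\<close> carrying the label \<open>i\<close>, so a labelling is given by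
  the inverses of the maps from edges at \<open>x\<close> to labels.\<close>

definition edge_labelling :: "'a ugraph \<Rightarrow> 'b ugraph \<Rightarrow> ('a \<Rightarrow> 'b \<Rightarrow> 'a set) \<Rightarrow> bool" where
  "edge_labelling G1 G2 l \<longleftrightarrow>
     (\<forall>x\<in>verts G1. bij_betw (l x) (verts G2) (incident_edges G1 x))"

definition replacement_product ::
  "'a ugraph \<Rightarrow> 'b ugraph \<Rightarrow> ('a \<Rightarrow> 'b \<Rightarrow> 'a set) \<Rightarrow> ('a \<times> 'b) ugraph" where
  "replacement_product G1 G2 l =
     \<lparr>verts = verts G1 \<times> verts G2,
      edges = {{(x, i), (y, j)} | x i y j.
        x \<in> verts G1 \<and> y \<in> verts G1 \<and> i \<in> verts G2 \<and> j \<in> verts G2 \<and> (x, i) \<noteq> (y, j) \<and>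
        (x = y \<and> {i, j} \<in> edges G2 \<or>
         {x, y} \<in> edges G1 \<and> l x i = {x, y} \<and> l y j = {x, y})}\<rparr>"

end

theory Submission
  imports Defs
begin

text \<open>An edge of the replacement product either lies in a copy \<open>{x} \<times> G2\<close> or is the unique lift
  of an edge of \<open>G1\<close>, so deleting a set \<open>F\<close> of product edges amounts to deleting edges
  from each copy and from \<open>G1\<close> (the \<^emph>\<open>traces\<close> of \<open>F\<close>).

  Upper bounds. The lift of an edge cut of \<open>G1\<close> cuts the product
  (\<open>edge_connectivity_product_le_base\<close>), and so does the set of the \<open>\<delta>\<^sub>2 + 1\<close> edges at one vertex
  (\<open>edge_connectivity_product_le_degree\<close>).

  Lower bounds. Let \<open>F\<close> have fewer than \<open>\<lambda>\<^sub>1\<close> edges. Its trace on \<open>G1\<close> leaves \<open>G1\<close> connected, so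
  the product stays connected as long as every copy does (\<open>connected_if_copies_connected\<close>),
  which is certain if also \<open>|F| < \<lambda>\<^sub>2\<close>. If \<open>|F| = \<lambda>\<^sub>2\<close>, a copy at \<open>x\<close> can be disconnected only if it
  absorbs all of \<open>F\<close>. Then nothing is deleted elsewhere; when \<open>\<kappa>\<^sub>1 \<ge> 2\<close> the part of the product over
  \<open>G1 - x\<close> is connected, and every vertex of the bad copy is still joined to that part by its own
  lifted edge (\<open>connected_if_cut_in_one_copy\<close>). Hence \<open>|F| < \<lambda>\<^sub>1\<close> and \<open>|F| \<le> \<lambda>\<^sub>2\<close> suffice for
  connectedness if \<open>\<kappa>\<^sub>1 \<ge> 2\<close>. This covers (c), where \<open>\<lambda>\<^sub>2 \<ge> \<lambda>\<^sub>1 - 1\<close> makes the second inequality follow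
  from the first, and (d), where the second one reads \<open>|F| < \<delta>\<^sub>2 + 1\<close>. For (a) it is enough that the
  product is connected.\<close>

section \<open>Connectivity of graphs\<close>

lemma finite_edges: "simple_graph G \<Longrightarrow> finite (edges G)"
  unfolding simple_graph_def by (meson Pow_iff finite_Pow_iff finite_subset subsetI)

lemma simple_edgeD:
  assumes "simple_graph G" "{x, y} \<in> edges G"
  shows "x \<in> verts G" "y \<in> verts G" "x \<noteq> y"
  using assms by (auto simp: simple_graph_def)

lemma del_no_edges [simp]: "del_edges G {} = G"
  by (cases G) (simp add: del_edges_def)

lemma rtrancl_adj_sym: "(x, y) \<in> (adj_rel G)\<^sup>* \<Longrightarrow> (y, x) \<in> (adj_rel G)\<^sup>*"
proof -
  have "sym (adj_rel G)"
    by (auto simp: sym_def adj_rel_def insert_commute)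
  then show "(x, y) \<in> (adj_rel G)\<^sup>* \<Longrightarrow> (y, x) \<in> (adj_rel G)\<^sup>*"
    using sym_rtrancl by (metis symD)
qed

lemma incident_edgeE:
  assumes "simple_graph G" "e \<in> incident_edges G x"
  obtains y where "e = {x, y}" "y \<in> verts G" "x \<noteq> y"
proof -
  have e: "e \<subseteq> verts G" "card e = 2" "x \<in> e"
    using assms by (auto simp: simple_graph_def incident_edges_def)
  then obtain a b where "e = {a, b}" "a \<noteq> b"
    by (meson card_2_iff)
  with e that show thesis
    by (cases "x = a") auto
qed

lemma disconnected_by_star:
  assumes "simple_graph G" "card (verts G) \<noteq> 1" "v \<in> verts G"
  shows "\<not> connected_graph (del_edges G (incident_edges G v))"
proof
  assume con: "connected_graph (del_edges G (incident_edges G v))"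
  have "\<not> verts G \<subseteq> {v}"
    using assms by (metis card_1_singleton_iff empty_iff One_nat_def subset_singletonD)
  then obtain w where w: "w \<in> verts G" "w \<noteq> v"
    by blast
  then have "(v, w) \<in> (adj_rel (del_edges G (incident_edges G v)))\<^sup>*"
    using con assms(3) by (simp add: connected_graph_def del_edges_def)
  then show False
    using w(2) by (auto elim: converse_rtranclE simp: adj_rel_def del_edges_def incident_edges_def)
qed

lemma edge_connectivity_le_card:
  assumes "simple_graph G" "F \<subseteq> edges G" "\<not> connected_graph (del_edges G F)"
  shows "edge_connectivity G \<le> card F"
proof -
  let ?C = "{card F | F. F \<subseteq> edges G \<and> \<not> connected_graph (del_edges G F)}"
  have "?C \<subseteq> card ` Pow (edges G)"
    by auto
  then have "finite ?C"
    using finite_edges[OF assms(1)] finite_subset by blast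
  then have "Min ?C \<le> card F"
    using assms by (intro Min_le) auto
  then show ?thesis
    by (auto simp: edge_connectivity_def)
qed

lemma edge_connectivity_attained:
  assumes "simple_graph G" "card (verts G) \<noteq> 1"
  obtains F where "F \<subseteq> edges G" "\<not> connected_graph (del_edges G F)"
    "card F = edge_connectivity G"
proof -
  let ?C = "{card F | F. F \<subseteq> edges G \<and> \<not> connected_graph (del_edges G F)}"
  have "?C \<subseteq> card ` Pow (edges G)"
    by auto
  then have fin: "finite ?C"
    using finite_edges[OF assms(1)] finite_subset by blast
  obtain v where "v \<in> verts G"
    using assms(1) by (auto simp: simple_graph_def)
  then have "card (incident_edges G v) \<in> ?C"
    using disconnected_by_star[OF assms] by (auto simp: incident_edges_def)
  then have "Min ?C \<in> ?C"
    using fin Min_in by blast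
  then show thesis
    using that assms(2) by (auto simp: edge_connectivity_def)
qed

lemma edge_connectivity_pos:
  assumes "simple_graph G" "card (verts G) \<noteq> 1" "connected_graph G"
  shows "edge_connectivity G \<ge> 1"
proof -
  obtain F where F: "F \<subseteq> edges G" "\<not> connected_graph (del_edges G F)"
    "card F = edge_connectivity G"
    using edge_connectivity_attained[OF assms(1,2)] .
  have "F \<noteq> {}"
    using F(2) assms(3) by auto
  moreover have "finite F"
    using F(1) finite_edges[OF assms(1)] finite_subset by blast
  ultimately show ?thesis
    using F(3) by (metis card_gt_0_iff less_eq_Suc_le One_nat_def)
qed

text \<open>The complete case needs its own argument, because there the vertex-connectivity is a
  convention instead of a minimum over cuts.\<close>

lemma connected_del_vert:
  assumes "simple_graph G" "vertex_connectivity G \<ge> 2" "x \<in> verts G"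
  shows "connected_graph (del_verts G {x})"
proof (cases "complete_graph G")
  case True
  then have "card (verts G) \<ge> 3"
    using assms(2) by (simp add: vertex_connectivity_def)
  then have "\<not> verts G \<subseteq> {x}"
    using card_mono[of "{x}" "verts G"] by auto
  moreover have "(a, b) \<in> (adj_rel (del_verts G {x}))\<^sup>*"
    if "a \<in> verts G - {x}" "b \<in> verts G - {x}" for a b
    using True that
    by (cases "a = b") (auto simp: complete_graph_def adj_rel_def del_verts_def)
  ultimately show ?thesis
    by (auto simp: connected_graph_def del_verts_def)
next
  case False
  let ?C = "{card S | S. S \<subset> verts G \<and> \<not> connected_graph (del_verts G S)}"
  have "Min ?C \<ge> 2"
    using assms(2) False by (simp add: vertex_connectivity_def)
  moreover have "?C \<subseteq> card ` Pow (verts G)"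
    by auto
  then have "finite ?C"
    using assms(1) by (meson simple_graph_def finite_Pow_iff finite_imageI finite_subset)
  ultimately have "1 \<notin> ?C"
    using Min_le[of ?C 1] by linarith
  moreover have "verts G \<noteq> {x}"
    using False by (auto simp: complete_graph_def)
  ultimately show ?thesis
    using assms(3) by force
qed

section \<open>Edges of the replacement product\<close>

locale replacement =
  fixes G1 :: "'a ugraph" and G2 :: "'b ugraph" and l :: "'a \<Rightarrow> 'b \<Rightarrow> 'a set"
  assumes simple1: "simple_graph G1" and simple2: "simple_graph G2"
    and labelling: "edge_labelling G1 G2 l"
begin

abbreviation P :: "('a \<times> 'b) ugraph" where
  "P \<equiv> replacement_product G1 G2 l"

definition copy_edge :: "'a \<Rightarrow> 'b set \<Rightarrow> ('a \<times> 'b) set" where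
  "copy_edge x e = {x} \<times> e"

text \<open>For an edge \<open>e = {x, y}\<close> of \<open>G1\<close> this is the product edge \<open>{(x, i), (y, j)}\<close> in which \<open>i\<close> and \<open>j\<close>
  are the labels of \<open>e\<close> at its two ends.\<close>

definition lift_edge :: "'a set \<Rightarrow> ('a \<times> 'b) set" where
  "lift_edge e = {(x, i). x \<in> e \<and> i \<in> verts G2 \<and> l x i = e}"

definition copy_trace :: "('a \<times> 'b) set set \<Rightarrow> 'a \<Rightarrow> 'b set set" where
  "copy_trace F x = {e \<in> edges G2. copy_edge x e \<in> F}"

definition base_trace :: "('a \<times> 'b) set set \<Rightarrow> 'a set set" where
  "base_trace F = {e \<in> edges G1. lift_edge e \<in> F}"

lemma verts_P [simp]: "verts P = verts G1 \<times> verts G2"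
  by (simp add: replacement_product_def)

lemma simple_P: "simple_graph P"
proof -
  have "finite (verts P)" "verts P \<noteq> {}"
    using simple1 simple2 by (auto simp: simple_graph_def)
  then show ?thesis
    unfolding simple_graph_def by (auto simp: replacement_product_def)
qed

lemma label_incident:
  assumes "x \<in> verts G1" "i \<in> verts G2"
  shows "l x i \<in> incident_edges G1 x"
  using labelling assms by (auto simp: edge_labelling_def bij_betw_def)

lemma label_inj:
  assumes "x \<in> verts G1" "i \<in> verts G2" "j \<in> verts G2" "l x i = l x j"
  shows "i = j"
  using labelling assms by (auto simp: edge_labelling_def bij_betw_def inj_on_def)

lemma label_exists:
  assumes "e \<in> edges G1" "x \<in> e"
  obtains i where "i \<in> verts G2" "l x i = e"
proof -
  have "x \<in> verts G1" "e \<in> incident_edges G1 x"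
    using assms simple1 by (auto simp: simple_graph_def incident_edges_def)
  then have "e \<in> l x ` verts G2"
    using labelling by (simp add: edge_labelling_def bij_betw_def)
  then show thesis
    using that by blast
qed

lemma lift_edge_eq:
  assumes "{x, y} \<in> edges G1" "i \<in> verts G2" "l x i = {x, y}" "j \<in> verts G2" "l y j = {x, y}"
  shows "lift_edge {x, y} = {(x, i), (y, j)}"
proof -
  have "x \<in> verts G1" "y \<in> verts G1"
    using simple_edgeD[OF simple1 assms(1)] by auto
  then have "a = x \<and> k = i \<or> a = y \<and> k = j"
    if "a \<in> {x, y}" "k \<in> verts G2" "l a k = {x, y}" for a k
    using that assms label_inj by (metis insert_iff singletonD)
  then show ?thesis
    using assms by (auto simp: lift_edge_def)
qed

lemma labelled_edge_in_P:
  assumes "{x, y} \<in> edges G1" "i \<in> verts G2" "l x i = {x, y}" "j \<in> verts G2" "l y j = {x, y}"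
  shows "{(x, i), (y, j)} \<in> edges P"
proof -
  have "x \<in> verts G1" "y \<in> verts G1" "(x, i) \<noteq> (y, j)"
    using simple_edgeD[OF simple1 assms(1)] by auto
  with assms show ?thesis
    unfolding replacement_product_def ugraph.simps by blast
qed

lemma copy_in_P:
  assumes "x \<in> verts G1" "{i, j} \<in> edges G2"
  shows "{(x, i), (x, j)} \<in> edges P"
proof -
  have "i \<in> verts G2" "j \<in> verts G2" "(x, i) \<noteq> (x, j)"
    using simple_edgeD[OF simple2 assms(2)] by auto
  with assms show ?thesis
    unfolding replacement_product_def ugraph.simps by blast
qed

lemma fst_lift_edge:
  assumes "e \<in> edges G1"
  shows "fst ` lift_edge e = e"
proof
  show "fst ` lift_edge e \<subseteq> e"
    by (auto simp: lift_edge_def)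
  show "e \<subseteq> fst ` lift_edge e"
  proof
    fix x assume "x \<in> e"
    then obtain i where "(x, i) \<in> lift_edge e"
      using label_exists[OF assms, of x] by (auto simp: lift_edge_def)
    then show "x \<in> fst ` lift_edge e"
      by (metis fst_conv image_eqI)
  qed
qed

lemma inj_lift_edge: "inj_on lift_edge (edges G1)"
  by (metis fst_lift_edge inj_onI)

lemma inj_copy_edge: "inj (copy_edge x)"
  by (auto simp: inj_def copy_edge_def)

text \<open>A lifted edge has its ends over two different vertices of \<open>G1\<close>, a copied edge over a single one.\<close>

lemma lift_neq_copy:
  assumes "e \<in> edges G1"
  shows "lift_edge e \<noteq> copy_edge x e'"
proof
  assume "lift_edge e = copy_edge x e'"
  then have "e \<subseteq> {x}"
    using fst_lift_edge[OF assms] by (auto simp: copy_edge_def split: if_splits)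
  then have "card e \<le> 1"
    using card_mono[of "{x}" e] by auto
  then show False
    using assms simple1 by (auto simp: simple_graph_def)
qed

lemma P_edge_cases:
  assumes "{(x, i), (y, j)} \<in> edges P"
  obtains (copy) "x = y" "{i, j} \<in> edges G2" "{(x, i), (y, j)} = copy_edge x {i, j}"
  | (lift) "{x, y} \<in> edges G1" "l x i = {x, y}" "{(x, i), (y, j)} = lift_edge {x, y}"
proof -
  obtain a b c d where ab: "{(x, i), (y, j)} = {(a, b), (c, d)}" "b \<in> verts G2" "d \<in> verts G2"
    and "a = c \<and> {b, d} \<in> edges G2 \<or> {a, c} \<in> edges G1 \<and> l a b = {a, c} \<and> l c d = {a, c}"
    using assms by (auto simp only: replacement_product_def ugraph.simps mem_Collect_eq)
  then consider "a = c" "{b, d} \<in> edges G2"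
    | "{a, c} \<in> edges G1" "l a b = {a, c}" "l c d = {a, c}"
    by blast
  then show thesis
  proof cases
    case 1
    moreover have "x = a" "y = a" "{i, j} = {b, d}"
      using ab(1) 1(1) by (auto simp: doubleton_eq_iff)
    ultimately show thesis
      using copy by (auto simp: copy_edge_def)
  next
    case 2
    moreover have "{x, y} = {a, c}" "x = a \<and> i = b \<or> x = c \<and> i = d"
      using ab(1) by (auto simp: doubleton_eq_iff)
    ultimately show thesis
      using lift lift_edge_eq[of a c b d] ab by auto
  qed
qed

section \<open>Upper bounds\<close>

text \<open>Contracting the copies maps a walk of the product to a walk of \<open>G1\<close>, in which only lifted edges
  move.\<close>

lemma connected_base_if_connected_lifts_deleted:
  assumes con: "connected_graph (del_edges P (lift_edge ` F))"
  shows "connected_graph (del_edges G1 F)"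
proof -
  let ?A = "adj_rel (del_edges P (lift_edge ` F))"
  let ?B = "adj_rel (del_edges G1 F)"
  have proj: "(fst p, fst q) \<in> ?B\<^sup>*" if "(p, q) \<in> ?A\<^sup>*" for p q
    using that
  proof induction
    case (step q r)
    obtain x i y j where qr: "q = (x, i)" "r = (y, j)"
      by (metis surj_pair)
    have e: "{(x, i), (y, j)} \<in> edges P" "{(x, i), (y, j)} \<notin> lift_edge ` F"
      using step.hyps(2) by (auto simp: qr adj_rel_def del_edges_def)
    from e(1) have "x = y \<or> (x, y) \<in> ?B"
      using e(2) by (cases rule: P_edge_cases) (auto simp: adj_rel_def del_edges_def)
    then show ?case
      using step.IH qr by (auto intro: rtrancl_into_rtrancl)
  qed simp
  obtain i where i: "i \<in> verts G2"
    using simple2 by (auto simp: simple_graph_def)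
  have "(x, y) \<in> ?B\<^sup>*" if "x \<in> verts G1" "y \<in> verts G1" for x y
    using con proj[of "(x, i)" "(y, i)"] that i by (auto simp: connected_graph_def del_edges_def)
  then show ?thesis
    using simple1 by (auto simp: connected_graph_def simple_graph_def del_edges_def)
qed

lemma lift_edge_in_P:
  assumes "e \<in> edges G1"
  shows "lift_edge e \<in> edges P"
proof -
  obtain x y where e: "e = {x, y}"
    using assms simple1 by (metis simple_graph_def card_2_iff)
  obtain i where i: "i \<in> verts G2" "l x i = {x, y}"
    using label_exists[OF assms, of x] e by blast
  obtain j where j: "j \<in> verts G2" "l y j = {x, y}"
    using label_exists[OF assms, of y] e by blast
  show ?thesis
    using lift_edge_eq[of x y i j] labelled_edge_in_P[of x y i j] assms e i j by auto
qed

lemma edge_connectivity_product_le_base: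
  assumes "card (verts G1) \<noteq> 1"
  shows "edge_connectivity P \<le> edge_connectivity G1"
proof -
  obtain F where F: "F \<subseteq> edges G1" "\<not> connected_graph (del_edges G1 F)"
    "card F = edge_connectivity G1"
    using edge_connectivity_attained[OF simple1 assms] .
  have "edge_connectivity P \<le> card (lift_edge ` F)"
    using F lift_edge_in_P connected_base_if_connected_lifts_deleted
    by (intro edge_connectivity_le_card[OF simple_P]) auto
  also have "\<dots> \<le> card F"
    using F(1) finite_edges[OF simple1] by (intro card_image_le) (rule finite_subset)
  finally show ?thesis
    using F(3) by simp
qed

lemma edge_connectivity_product_le_degree:
  assumes "regular_graph G2 d" "card (verts G1) \<noteq> 1"
  shows "edge_connectivity P \<le> d + 1"
proof -
  obtain x i where xi: "x \<in> verts G1" "i \<in> verts G2"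
    using simple1 simple2 by (auto simp: simple_graph_def)
  have "card (verts P) \<noteq> 1"
    using assms(2) by (simp add: card_cartesian_product)
  then have "\<not> connected_graph (del_edges P (incident_edges P (x, i)))"
    using disconnected_by_star[OF simple_P] xi by simp
  then have "edge_connectivity P \<le> card (incident_edges P (x, i))"
    by (intro edge_connectivity_le_card[OF simple_P]) (auto simp: incident_edges_def)
  also have "incident_edges P (x, i)
      \<subseteq> insert (lift_edge (l x i)) (copy_edge x ` incident_edges G2 i)"
  proof
    fix e assume e: "e \<in> incident_edges P (x, i)"
    then obtain y j where yj: "e = {(x, i), (y, j)}"
      using simple_P by (metis incident_edgeE surj_pair)
    then have "{(x, i), (y, j)} \<in> edges P"
      using e by (simp add: incident_edges_def)
    then show "e \<in> insert (lift_edge (l x i)) (copy_edge x ` incident_edges G2 i)"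
      using yj by (cases rule: P_edge_cases) (auto simp: incident_edges_def)
  qed
  then have "card (incident_edges P (x, i))
      \<le> card (insert (lift_edge (l x i)) (copy_edge x ` incident_edges G2 i))"
    using finite_edges[OF simple2] by (intro card_mono) (auto simp: incident_edges_def)
  also have "\<dots> \<le> Suc (card (copy_edge x ` incident_edges G2 i))"
    by (rule card_insert_le_m1) simp_all
  also have "\<dots> = d + 1"
    using assms(1) xi(2) inj_copy_edge[of x]
    by (simp add: card_image inj_on_subset regular_graph_def)
  finally show ?thesis .
qed

section \<open>Lower bounds\<close>

lemma card_copy_trace_le: "finite F \<Longrightarrow> card (copy_trace F x) \<le> card F"
  by (rule card_inj_on_le[of "copy_edge x"])
    (auto simp: copy_trace_def intro: inj_on_subset[OF inj_copy_edge])

lemma card_base_trace_le: "finite F \<Longrightarrow> card (base_trace F) \<le> card F"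
  by (rule card_inj_on_le[of lift_edge])
    (auto simp: base_trace_def intro: inj_on_subset[OF inj_lift_edge])

lemma reach_in_copy:
  assumes "x \<in> verts G1" "connected_graph (del_edges G2 (copy_trace F x))"
    and "i \<in> verts G2" "j \<in> verts G2"
  shows "((x, i), (x, j)) \<in> (adj_rel (del_edges P F))\<^sup>*"
proof -
  have "(i, j) \<in> (adj_rel (del_edges G2 (copy_trace F x)))\<^sup>*"
    using assms by (simp add: connected_graph_def del_edges_def)
  then show ?thesis
  proof induction
    case (step a b)
    then have "{a, b} \<in> edges G2" "copy_edge x {a, b} \<notin> F"
      by (auto simp: adj_rel_def del_edges_def copy_trace_def)
    then have "((x, a), (x, b)) \<in> adj_rel (del_edges P F)"
      using copy_in_P[OF assms(1)] by (auto simp: adj_rel_def del_edges_def copy_edge_def)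
    then show ?case
      using step.IH by simp
  qed simp
qed

lemma adj_via_lift:
  assumes "{x, y} \<in> edges G1" "lift_edge {x, y} \<notin> F" "i \<in> verts G2" "l x i = {x, y}"
  obtains j where "j \<in> verts G2" "((x, i), (y, j)) \<in> adj_rel (del_edges P F)"
proof -
  obtain j where j: "j \<in> verts G2" "l y j = {x, y}"
    using label_exists[OF assms(1), of y] by auto
  then have "{(x, i), (y, j)} \<in> edges P - F"
    using assms labelled_edge_in_P[of x y i j] lift_edge_eq[of x y i j] by auto
  then show thesis
    using that j by (auto simp: adj_rel_def del_edges_def)
qed

text \<open>Inside connected copies a path of the base can be followed with arbitrary labels at its
  ends: between two consecutive lifted edges the walk moves within a copy. Taking for \<open>H\<close> a
  subgraph on part of \<open>G1\<close> covers the case in which one copy has to be avoided.\<close>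

lemma reach_along_base_path:
  assumes path: "(x, y) \<in> (adj_rel H)\<^sup>*" and x: "x \<in> verts H"
    and H: "simple_graph H" "verts H \<subseteq> verts G1" "edges H \<subseteq> edges G1 - base_trace F"
    and copies: "\<And>z. z \<in> verts H \<Longrightarrow> connected_graph (del_edges G2 (copy_trace F z))"
    and i: "i \<in> verts G2" and j: "j \<in> verts G2"
  shows "((x, i), (y, j)) \<in> (adj_rel (del_edges P F))\<^sup>*"
  using path j
proof (induction arbitrary: j)
  case base
  then show ?case
    using reach_in_copy x H(2) copies i by blast
next
  case (step y z)
  have yz: "{y, z} \<in> edges H"
    using step.hyps(2) by (simp add: adj_rel_def)
  then have z: "z \<in> verts H"
    using simple_edgeD[OF H(1)] by blast
  have e: "{y, z} \<in> edges G1" "lift_edge {y, z} \<notin> F"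
    using yz H(3) by (auto simp: base_trace_def)
  obtain a where a: "a \<in> verts G2" "l y a = {y, z}"
    using label_exists[OF e(1), of y] by auto
  obtain b where b: "b \<in> verts G2" "((y, a), (z, b)) \<in> adj_rel (del_edges P F)"
    using adj_via_lift[OF e a] .
  have "((z, b), (z, j)) \<in> (adj_rel (del_edges P F))\<^sup>*"
    using reach_in_copy z H(2) copies b(1) step.prems by blast
  then show ?case
    using step.IH[OF a(1)] b(2) by (meson rtrancl_into_rtrancl rtrancl_trans)
qed

lemma connected_if_copies_connected:
  assumes "connected_graph (del_edges G1 (base_trace F))"
    and "\<And>x. x \<in> verts G1 \<Longrightarrow> connected_graph (del_edges G2 (copy_trace F x))"
  shows "connected_graph (del_edges P F)"
proof -
  let ?H = "del_edges G1 (base_trace F)"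
  have "((x, i), (y, j)) \<in> (adj_rel (del_edges P F))\<^sup>*"
    if "x \<in> verts G1" "y \<in> verts G1" "i \<in> verts G2" "j \<in> verts G2" for x y i j
  proof (rule reach_along_base_path[where H = ?H])
    show "(x, y) \<in> (adj_rel ?H)\<^sup>*"
      using assms(1) that by (simp add: connected_graph_def del_edges_def)
    show "simple_graph ?H"
      using simple1 by (auto simp: simple_graph_def del_edges_def)
  qed (use that assms(2) in \<open>auto simp: del_edges_def\<close>)
  then show ?thesis
    using simple_P by (auto simp: connected_graph_def del_edges_def simple_graph_def)
qed

text \<open>Each vertex of the damaged copy \<open>x\<close> keeps its lifted edge, which ends in an undamaged copy.\<close>

lemma connected_if_cut_in_one_copy:
  assumes con1: "connected_graph (del_verts G1 {x})" and con2: "connected_graph G2"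
    and x: "x \<in> verts G1" and F: "F \<subseteq> range (copy_edge x)"
  shows "connected_graph (del_edges P F)"
proof -
  let ?R = "(adj_rel (del_edges P F))\<^sup>*" and ?H = "del_verts G1 {x}"
  have lifts: "lift_edge e \<notin> F" if "e \<in> edges G1" for e
    using lift_neq_copy[OF that, of x] F by blast
  have "copy_trace F z = {}" if "z \<noteq> x" for z
  proof -
    have "copy_edge z e \<noteq> copy_edge x e'" if "e \<in> edges G2" for e e'
      using that simple2 \<open>z \<noteq> x\<close> by (force simp: copy_edge_def times_eq_iff simple_graph_def)
    then show ?thesis
      using F by (fastforce simp: copy_trace_def)
  qed
  then have copies: "connected_graph (del_edges G2 (copy_trace F z))" if "z \<in> verts ?H" for z
    using that con2 by (simp add: del_verts_def)
  have outside: "((y, i), (z, j)) \<in> ?R"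
    if "y \<in> verts ?H" "z \<in> verts ?H" "i \<in> verts G2" "j \<in> verts G2" for y z i j
  proof (rule reach_along_base_path[where H = ?H])
    show "(y, z) \<in> (adj_rel ?H)\<^sup>*"
      using con1 that by (simp add: connected_graph_def)
    show "simple_graph ?H"
      using simple1 con1 by (auto simp: simple_graph_def connected_graph_def del_verts_def)
    show "edges ?H \<subseteq> edges G1 - base_trace F"
      using lifts by (auto simp: del_verts_def base_trace_def)
  qed (use that copies in \<open>auto simp: del_verts_def\<close>)
  have escape: "\<exists>y j. y \<in> verts ?H \<and> j \<in> verts G2 \<and> (p, (y, j)) \<in> ?R" if "p \<in> verts P" for p
  proof -
    obtain z i where p: "p = (z, i)" "z \<in> verts G1" "i \<in> verts G2"
      using \<open>p \<in> verts P\<close> by auto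
    show ?thesis
    proof (cases "z = x")
      case True
      have inc: "l x i \<in> incident_edges G1 x"
        using label_incident x p(3) .
      then obtain y where y: "l x i = {x, y}" "y \<in> verts G1" "x \<noteq> y"
        using incident_edgeE simple1 by metis
      have e: "{x, y} \<in> edges G1"
        using inc y(1) by (simp add: incident_edges_def)
      obtain j where "j \<in> verts G2" "((x, i), (y, j)) \<in> adj_rel (del_edges P F)"
        using adj_via_lift[OF e lifts[OF e] p(3) y(1)] .
      then show ?thesis
        using True p y by (auto simp: del_verts_def)
    next
      case False
      then show ?thesis
        using p by (auto simp: del_verts_def)
    qed
  qed
  have "(p, q) \<in> ?R" if "p \<in> verts P" "q \<in> verts P" for p q
    using escape[OF that(1)] escape[OF that(2)] outside rtrancl_adj_sym rtrancl_trans by metis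
  then show ?thesis
    using simple_P by (auto simp: connected_graph_def del_edges_def simple_graph_def)
qed

lemma connected_del_edges_if_card_less:
  assumes "F \<subseteq> edges P" "card F < edge_connectivity G1" "card F < edge_connectivity G2"
  shows "connected_graph (del_edges P F)"
proof (rule connected_if_copies_connected)
  have fin: "finite F"
    using assms(1) finite_edges[OF simple_P] finite_subset by blast
  show "connected_graph (del_edges G1 (base_trace F))"
    using edge_connectivity_le_card[OF simple1, of "base_trace F"] card_base_trace_le[OF fin] assms(2)
    by (force simp: base_trace_def)
  show "connected_graph (del_edges G2 (copy_trace F x))" for x
    using edge_connectivity_le_card[OF simple2, of "copy_trace F x"]
      card_copy_trace_le[OF fin, of x] assms(3)
    by (force simp: copy_trace_def)
qed

text \<open>Connectedness of \<open>G1 - x\<close> buys the equality case \<open>|F| = \<lambda>\<^sub>2\<close>: a copy disconnected by its trace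
  has a trace of size \<open>|F|\<close>, so by injectivity of \<open>copy_edge x\<close> it contains the whole of \<open>F\<close>.\<close>

lemma connected_del_edges_if_card_le:
  assumes "F \<subseteq> edges P" "card F < edge_connectivity G1" "card F \<le> edge_connectivity G2"
    and con2: "connected_graph G2" and kappa: "vertex_connectivity G1 \<ge> 2"
  shows "connected_graph (del_edges P F)"
proof -
  have fin: "finite F"
    using assms(1) finite_edges[OF simple_P] finite_subset by blast
  show ?thesis
  proof (cases "\<forall>x\<in>verts G1. connected_graph (del_edges G2 (copy_trace F x))")
    case True
    have "connected_graph (del_edges G1 (base_trace F))"
      using edge_connectivity_le_card[OF simple1, of "base_trace F"] card_base_trace_le[OF fin]
        assms(2)
      by (force simp: base_trace_def)
    with True show ?thesis
      using connected_if_copies_connected by blast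
  next
    case False
    then obtain x where x: "x \<in> verts G1" "\<not> connected_graph (del_edges G2 (copy_trace F x))"
      by blast
    then have "card F \<le> card (copy_trace F x)"
      using edge_connectivity_le_card[OF simple2, of "copy_trace F x"] assms(3)
      by (force simp: copy_trace_def)
    also have "\<dots> = card (copy_edge x ` copy_trace F x)"
      by (metis card_image inj_copy_edge inj_on_subset subset_UNIV)
    finally have "copy_edge x ` copy_trace F x = F"
      by (intro card_seteq[OF fin]) (auto simp: copy_trace_def)
    then have "F \<subseteq> range (copy_edge x)"
      by blast
    then show ?thesis
      using connected_if_cut_in_one_copy[OF connected_del_vert[OF simple1 kappa x(1)] con2 x(1)] by blast
  qed
qed

end

section \<open>Edge-connectivity of the replacement product\<close>

theorem corollary3p2:
  fixes G1 :: "'a ugraph" and G2 :: "'b ugraph"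
    and l :: "'a \<Rightarrow> 'b \<Rightarrow> 'a set" and n \<delta>\<^sub>1 \<delta>\<^sub>2 :: nat
  assumes "simple_graph G1" and "connected_graph G1" and "regular_graph G1 \<delta>\<^sub>1"
    and "card (verts G1) = n"
    and "simple_graph G2" and "connected_graph G2" and "regular_graph G2 \<delta>\<^sub>2"
    and "card (verts G2) = \<delta>\<^sub>1"
    and "edge_labelling G1 G2 l"
  shows "(edge_connectivity G1 = 1 \<longrightarrow>
            edge_connectivity (replacement_product G1 G2 l) = 1)
    \<and> (edge_connectivity G2 \<ge> edge_connectivity G1 \<longrightarrow>
         edge_connectivity (replacement_product G1 G2 l) = edge_connectivity G1)
    \<and> (vertex_connectivity G1 \<ge> 2 \<and> int (edge_connectivity G2) \<ge> int (edge_connectivity G1) - 1 \<longrightarrow>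
         edge_connectivity (replacement_product G1 G2 l) = edge_connectivity G1)
    \<and> (vertex_connectivity G1 \<ge> 2 \<and> edge_connectivity G2 = \<delta>\<^sub>2 \<longrightarrow>
         edge_connectivity (replacement_product G1 G2 l) = min (edge_connectivity G1) (\<delta>\<^sub>2 + 1))"
proof -
  interpret replacement G1 G2 l
    using assms by unfold_locales auto
  \<comment> \<open>A label exists, hence an edge at any vertex, so \<open>G1\<close> is not a single vertex.\<close>
  obtain x i where xi: "x \<in> verts G1" "i \<in> verts G2"
    using assms(1,5) by (auto simp: simple_graph_def)
  then obtain y where "y \<in> verts G1" "x \<noteq> y"
    using incident_edgeE[OF simple1 label_incident] by metis
  then have n: "card (verts G1) \<noteq> 1"
    using xi(1) by (auto simp: card_1_singleton_iff)
  then have nP: "card (verts P) \<noteq> 1"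
    by (simp add: card_cartesian_product)
  have upper: "edge_connectivity P \<le> edge_connectivity G1"
    using edge_connectivity_product_le_base[OF n] .
  have upper': "edge_connectivity P \<le> \<delta>\<^sub>2 + 1"
    using edge_connectivity_product_le_degree[OF assms(7) n] .
  obtain F where F: "F \<subseteq> edges P" "\<not> connected_graph (del_edges P F)"
    "card F = edge_connectivity P"
    using edge_connectivity_attained[OF simple_P nP] .
  have "connected_graph P"
    using connected_if_copies_connected[of "{}"] assms(2,6)
    by (simp add: copy_trace_def base_trace_def)
  then have a: "edge_connectivity P \<ge> 1"
    using edge_connectivity_pos[OF simple_P nP] by blast
  have b: "edge_connectivity P \<ge> edge_connectivity G1 \<or> edge_connectivity P \<ge> edge_connectivity G2"
    using connected_del_edges_if_card_less[OF F(1)] F(2,3) by force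
  have cd: "edge_connectivity P \<ge> edge_connectivity G1 \<or> edge_connectivity P > edge_connectivity G2"
    if "vertex_connectivity G1 \<ge> 2"
    using connected_del_edges_if_card_le[OF F(1) _ _ assms(6) that] F(2,3) by force
  show ?thesis
    using upper upper' a b cd by (auto simp: min_def)
qed

end
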